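(* Let $n>1$ be a real number, let $m\ge0$ be an integer, and let $$D(z)=n\,J_m'(nz)\,H_m(z)-J_m(nz)\,H_m'(z).$$ Then all roots of $D$ except, possibly, $z=0$ are simple.
   Context: $J_m$ is the Bessel function of the first kind of order $m$ and $H_m=H_m^{(1)}$ is the Hankel function of the first kind of order $m$ (principal branch), as functions of a complex variable; $'$ denotes the derivative of the function with respect to its argument. A root $z_0\neq 0$ of $D$ is simple if $D'(z_0)\neq0$. *)

theory Defs
  imports "HOL-Complex_Analysis.Complex_Analysis"
begin

definition Bessel_J :: "nat \<Rightarrow> complex \<Rightarrow> complex" where
  "Bessel_J m z =
     (\<Sum>k. (-1) ^ k / (fact k * fact (k + m)) * (z / 2) ^ (2 * k + m))"

text \<open>
  The principal branch of the Bessel function of the second kind (Weber's function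
  \<open>Y\<^sub>m\<close>) of integer order, given by its ascending series (Abramowitz--Stegun 9.1.11,
  DLMF 10.8.1). The branch is that of \<^const>\<open>Ln\<close>, so the function is holomorphic off the
  closed negative real axis, which is its branch cut.
\<close>
definition Bessel_Y :: "nat \<Rightarrow> complex \<Rightarrow> complex" where
  "Bessel_Y m z =
     2 / of_real pi * Ln (z / 2) * Bessel_J m z
     - 1 / of_real pi * (z / 2) powi (- int m) *
         (\<Sum>k<m. fact (m - k - 1) / fact k * (z\<^sup>2 / 4) ^ k)
     - 1 / of_real pi * (z / 2) ^ m *
         (\<Sum>k. (Digamma (of_nat (k + 1)) + Digamma (of_nat (m + k + 1))) *
                (- (z\<^sup>2 / 4)) ^ k / (fact k * fact (m + k)))"

definition Hankel_H1 :: "nat \<Rightarrow> complex \<Rightarrow> complex" where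
  "Hankel_H1 m z = Bessel_J m z + \<i> * Bessel_Y m z"

definition char_D :: "real \<Rightarrow> nat \<Rightarrow> complex \<Rightarrow> complex" where
  "char_D n m z =
     of_real n * deriv (Bessel_J m) (of_real n * z) * Hankel_H1 m z
     - Bessel_J m (of_real n * z) * deriv (Hankel_H1 m) z"

text \<open>
  On the branch cut \<^term>\<open>\<real>\<^sub>\<le>\<^sub>0 :: complex set\<close> the derivative of \<^const>\<open>Hankel_H1\<close> does not
  exist, so \<^const>\<open>char_D\<close> is meaningful only off the cut.
\<close>

end

theory Submission
  imports Defs
begin

text \<open>
  By Bessel's equation, $D' = -D/z - (n^2-1) J_m(nz) H_m(z)$, so at a double root $J_m(nz) H_m(z) = 0$.
  Then $D = 0$ and the nonvanishing of the Wronskian of $J_m$ and $H_m$ force $J_m(nz) = 0 = H_m(z)$.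
  All nonzero zeros of $J_m$ are real, so $z > 0$; there $J_m$ and $Y_m$ are real, and $H_m(z) = 0$ gives
  $J_m(z) = Y_m(z) = 0$, contradicting the Wronskian of $J_m$ and $Y_m$.

  Derivatives are taken throughout with the Euler operator $\vartheta = z\,d/dz$, for which Bessel's
  equation reads $\vartheta^2 f = (m^2 - z^2) f$.
\<close>

text \<open>The factor n^2 - 1 arises because J_m(nz) and H_m(z) solve equations that differ only in
  the coefficient of z^2. The expression z D(z) is a Wronskian of the two, and in its derivative
  everything cancels except that difference. The laborious ingredient is Y_m. It is given by a
  logarithm, a finite sum starting at z^(-m) and a series with digamma values, so that it solves
  Bessel's equation has to be proved. The Euler operator suits this: on (z/2)^p times a series in
  z^2 it multiplies the k-th coefficient by 2k + p and moves no index, so the equation turns into a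
  recurrence for the coefficients. Neither of the two sums satisfies the homogeneous recurrence in
  general; their defects cancel against each other and against the defect of the logarithmic term.
  All statements about H_m live on the plane cut along the nonpositive real axis. This region is
  connected, so Wronskians are constant on it, and it is stable under multiplication by n >
  0.\<close>

section \<open>Everywhere convergent power series and the Euler operator\<close>

definition entire_coeffs :: "(nat \<Rightarrow> complex) \<Rightarrow> bool" where
  "entire_coeffs c \<longleftrightarrow> (\<forall>w. summable (\<lambda>k. c k * w ^ k))"

definition pser :: "(nat \<Rightarrow> complex) \<Rightarrow> complex \<Rightarrow> complex" where
  "pser c w = (\<Sum>k. c k * w ^ k)"

text \<open>The Frobenius form of a solution. The exponent is an integer so that the finite sum in
  \<open>Bessel_Y\<close>, with p = -m, is covered together with the series, where p = m.\<close>

definition bser :: "int \<Rightarrow> (nat \<Rightarrow> complex) \<Rightarrow> complex \<Rightarrow> complex" where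
  "bser p c z = (z / 2) powi p * pser c (z\<^sup>2 / 4)"

lemma pser_sums: "entire_coeffs c \<Longrightarrow> (\<lambda>k. c k * w ^ k) sums pser c w"
  by (simp add: entire_coeffs_def pser_def summable_sums)

lemma pser_0 [simp]: "pser c 0 = c 0"
  by (simp add: pser_def powser_zero)

lemma isCont_pser: "entire_coeffs c \<Longrightarrow> isCont (pser c) w"
  unfolding entire_coeffs_def pser_def by (rule isCont_powser_converges_everywhere) blast

lemma continuous_on_pser [continuous_intros]:
  assumes "entire_coeffs c" "continuous_on A f"
  shows "continuous_on A (\<lambda>x. pser c (f x))"
  using continuous_on_compose2[of UNIV "pser c" A f] isCont_pser assms
  by (auto simp: continuous_on_eq_continuous_at)

lemma entire_coeffs_add: 
  assumes "entire_coeffs c" "entire_coeffs d"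
  shows "entire_coeffs (\<lambda>k. c k + d k)" and "pser (\<lambda>k. c k + d k) w = pser c w + pser d w"
proof -
  have "(\<lambda>k. (c k + d k) * w ^ k) sums (pser c w + pser d w)" for w
    using sums_add[OF assms[THEN pser_sums]] by (simp add: algebra_simps)
  then show "entire_coeffs (\<lambda>k. c k + d k)" "pser (\<lambda>k. c k + d k) w = pser c w + pser d w"
    by (auto simp: entire_coeffs_def pser_def sums_iff)
qed

lemma entire_coeffs_cmult:
  assumes "entire_coeffs c"
  shows "entire_coeffs (\<lambda>k. a * c k)" and "pser (\<lambda>k. a * c k) w = a * pser c w"
proof -
  have "(\<lambda>k. (a * c k) * w ^ k) sums (a * pser c w)" for w
    using sums_mult[OF assms[THEN pser_sums], of a] by (simp add: algebra_simps)
  then show "entire_coeffs (\<lambda>k. a * c k)" "pser (\<lambda>k. a * c k) w = a * pser c w"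
    by (auto simp: entire_coeffs_def pser_def sums_iff)
qed

lemma entire_coeffs_shift:
  assumes "entire_coeffs c"
  shows "entire_coeffs (case_nat 0 c)" and "pser (case_nat 0 c) w = w * pser c w"
proof -
  have "(\<lambda>k. case_nat 0 c k * w ^ k) sums (w * pser c w)" for w
    using sums_mult[OF assms[THEN pser_sums], of w w]
    by (subst sums_Suc_iff[of "\<lambda>k. case_nat 0 c k * w ^ k" "w * pser c w", simplified, symmetric])
       (simp add: algebra_simps)
  then show "entire_coeffs (case_nat 0 c)" "pser (case_nat 0 c) w = w * pser c w"
    by (auto simp: entire_coeffs_def pser_def sums_iff)
qed

lemma pser_single:
  shows "entire_coeffs (\<lambda>k. if k = i then a else 0)"
    and "pser (\<lambda>k. if k = i then a else 0) w = a * w ^ i"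
proof -
  have "(\<lambda>k. (if k = i then a else 0) * w ^ k) sums (a * w ^ i)" for w
    using sums_single[of i "\<lambda>k. a * w ^ k"] by (simp add: if_distrib[of "\<lambda>x. x * _"] cong: if_cong)
  then show "entire_coeffs (\<lambda>k. if k = i then a else 0)"
    "pser (\<lambda>k. if k = i then a else 0) w = a * w ^ i"
    by (auto simp: entire_coeffs_def pser_def sums_iff)
qed

text \<open>Only the product of w with the derivative is recorded: it has coefficients k c_k,
  without the index shift of \<open>diffs\<close>, and needs no division at w = 0.\<close>

lemma pser_euler:
  assumes "entire_coeffs c"
  shows "entire_coeffs (\<lambda>k. of_nat k * c k)"
    and "\<exists>d. (pser c has_field_derivative d) (at w) \<and> w * d = pser (\<lambda>k. of_nat k * c k) w"
proof -
  have s: "summable (\<lambda>k. c k * w ^ k)" for w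
    using assms by (simp add: entire_coeffs_def)
  have *: "(\<lambda>k. (of_nat k * c k) * w ^ k) sums (w * (\<Sum>k. diffs c k * w ^ k))" for w
  proof -
    have "w * (of_nat k * c k * w ^ (k - Suc 0)) = (of_nat k * c k) * w ^ k" for k
      by (cases k) auto
    then show ?thesis
      using sums_mult[OF diffs_equiv[OF termdiff_converges_all[OF s]], of w w] by (simp only:)
  qed
  then show "entire_coeffs (\<lambda>k. of_nat k * c k)"
    by (auto simp: entire_coeffs_def sums_iff)
  have "(pser c has_field_derivative (\<Sum>k. diffs c k * w ^ k)) (at w)"
    using termdiffs_strong_converges_everywhere[OF s] unfolding pser_def .
  moreover have "w * (\<Sum>k. diffs c k * w ^ k) = pser (\<lambda>k. of_nat k * c k) w"
    using * by (simp add: pser_def sums_iff)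
  ultimately show "\<exists>d. (pser c has_field_derivative d) (at w) \<and> w * d = pser (\<lambda>k. of_nat k * c k) w"
    by blast
qed

text \<open>The Euler operator in z is diagonal on the monomials (z/2)^p (z^2/4)^k, with eigenvalue
  2k + p.\<close>

abbreviation euler_coeffs :: "int \<Rightarrow> (nat \<Rightarrow> complex) \<Rightarrow> nat \<Rightarrow> complex" where
  "euler_coeffs p c \<equiv> (\<lambda>k. of_int (2 * int k + p) * c k)"

lemma euler_coeffs_eq:
  assumes "entire_coeffs c"
  shows "entire_coeffs (euler_coeffs p c)"
    and "pser (euler_coeffs p c) w = 2 * pser (\<lambda>k. of_nat k * c k) w + of_int p * pser c w"
proof -
  have eq: "euler_coeffs p c = (\<lambda>k. 2 * (of_nat k * c k) + of_int p * c k)"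
    by (simp add: algebra_simps)
  note e = entire_coeffs_cmult[OF pser_euler(1)[OF assms], of 2] entire_coeffs_cmult[OF assms, of "of_int p"]
  show "entire_coeffs (euler_coeffs p c)"
    "pser (euler_coeffs p c) w = 2 * pser (\<lambda>k. of_nat k * c k) w + of_int p * pser c w"
    using entire_coeffs_add[OF e(1,3)] e(2,4) unfolding eq by auto
qed

lemma bser_deriv:
  assumes "entire_coeffs c" "z \<noteq> 0"
  shows "(bser p c has_field_derivative bser p (euler_coeffs p c) z / z) (at z)"
proof -
  obtain d where d: "(pser c has_field_derivative d) (at (z\<^sup>2 / 4))"
      "z\<^sup>2 / 4 * d = pser (\<lambda>k. of_nat k * c k) (z\<^sup>2 / 4)"
    using pser_euler(2)[OF assms(1)] by blast
  have p: "(z / 2) powi (p - 1) = (z / 2) powi p * (2 / z)"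
    using assms(2) by (simp add: power_int_diff)
  have "((\<lambda>z. pser c (z\<^sup>2 / 4)) has_field_derivative d * (z / 2)) (at z)"
    by (rule DERIV_chain2[where f = "pser c" and g = "\<lambda>z. z\<^sup>2 / 4", OF d(1)])
       (auto intro!: derivative_eq_intros)
  note this[derivative_intros]
  have "(bser p c has_field_derivative
     of_int p * (z / 2) powi (p - 1) / 2 * pser c (z\<^sup>2 / 4) + (z / 2) powi p * (d * (z / 2))) (at z)"
    unfolding bser_def [abs_def] using assms(2)
    by (auto intro!: derivative_eq_intros)
  also have "of_int p * (z / 2) powi (p - 1) / 2 * pser c (z\<^sup>2 / 4) + (z / 2) powi p * (d * (z / 2))
      = (z / 2) powi p * (2 * (z\<^sup>2 / 4 * d) + of_int p * pser c (z\<^sup>2 / 4)) / z"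
    using assms(2) unfolding p by (simp add: field_simps power2_eq_square)
  also have "\<dots> = bser p (euler_coeffs p c) z / z"
    unfolding bser_def euler_coeffs_eq(2)[OF assms(1)] d(2) ..
  finally show ?thesis .
qed

text \<open>Coefficientwise, (2k + p)^2 - p^2 = 4k(k + p), while multiplication by z^2 = 4 (z^2/4)
  is four times a shift, written \<open>case_nat 0 c\<close>. Bessel's equation is thus the
  vanishing of the coefficients on the right.\<close>

lemma bser_bessel_operator:
  assumes "entire_coeffs c"
  shows "bser p (euler_coeffs p (euler_coeffs p c)) z + (z\<^sup>2 - of_int p ^ 2) * bser p c z =
    bser p (\<lambda>k. 4 * (of_nat k * of_int (int k + p) * c k + case_nat 0 c k)) z"
proof -
  let ?E = "euler_coeffs p (euler_coeffs p c)"
  note E = euler_coeffs_eq(1)[OF euler_coeffs_eq(1)[OF assms], of p p]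
  note e1 = entire_coeffs_cmult[OF assms, of "- (of_int p ^ 2)"]
  note e2 = entire_coeffs_cmult[OF entire_coeffs_shift(1)[OF assms], of 4]
  have eq: "(\<lambda>k. 4 * (of_nat k * of_int (int k + p) * c k + case_nat 0 c k)) =
    (\<lambda>k. (?E k + - (of_int p ^ 2) * c k) + 4 * case_nat 0 c k)"
    by (rule ext) (simp add: algebra_simps power2_eq_square)
  show ?thesis
    unfolding bser_def eq entire_coeffs_add(2)[OF entire_coeffs_add(1)[OF E e1(1)] e2(1)]
      entire_coeffs_add(2)[OF E e1(1)] e1(2) e2(2) entire_coeffs_shift(2)[OF assms]
    by (simp add: algebra_simps)
qed

lemma entire_coeffs_fact:
  assumes "\<And>k. norm (c k) \<le> B * r ^ k / fact k"
  shows "entire_coeffs c"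
  unfolding entire_coeffs_def
proof
  fix w :: complex
  have "summable (\<lambda>k. B * (inverse (fact k) * (r * norm w) ^ k))"
    by (intro summable_mult summable_exp)
  then show "summable (\<lambda>k. c k * w ^ k)"
  proof (rule summable_comparison_test'[where N = 0])
    fix k
    have "norm (c k * w ^ k) \<le> B * r ^ k / fact k * norm w ^ k"
      unfolding norm_mult norm_power by (intro mult_right_mono assms) auto
    then show "norm (c k * w ^ k) \<le> B * (inverse (fact k) * (r * norm w) ^ k)"
      by (simp add: field_simps power_mult_distrib)
  qed
qed

lemma pser_Reals:
  assumes "entire_coeffs c" "\<And>k. c k \<in> \<real>" "w \<in> \<real>"
  shows "pser c w \<in> \<real>"
proof -
  have "(\<lambda>k. Im (c k * w ^ k)) sums Im (pser c w)"
    by (rule bounded_linear.sums[OF bounded_linear_Im pser_sums[OF assms(1)]])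
  moreover have "Im (c k * w ^ k) = 0" for k
    using assms(2,3) by (metis Reals_mult Reals_power complex_is_Real_iff)
  ultimately show ?thesis
    by (simp add: complex_is_Real_iff sums_iff)
qed

section \<open>The coefficient sequences of J and Y and their recurrences\<close>

definition coeff_J :: "nat \<Rightarrow> nat \<Rightarrow> complex" where
  "coeff_J m k = (-1) ^ k / (fact k * fact (k + m))"

text \<open>Padding by zeros lets the finite sum in \<open>Bessel_Y\<close> be treated as a power
  series like the others.\<close>

definition coeff_S :: "nat \<Rightarrow> nat \<Rightarrow> complex" where
  "coeff_S m k = (if k < m then fact (m - k - 1) / fact k else 0)"

definition coeff_T :: "nat \<Rightarrow> nat \<Rightarrow> complex" where
  "coeff_T m k = (Digamma (of_nat (k + 1)) + Digamma (of_nat (m + k + 1))) * (-1) ^ k /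
     (fact k * fact (m + k))"

lemma norm_div_fact_le: "norm (x / (fact k * fact j) :: complex) \<le> norm x / fact k"
  by (simp add: norm_divide norm_mult divide_simps mult_le_cancel_left1 fact_ge_1)

lemma entire_coeff_J: "entire_coeffs (coeff_J m)"
proof (rule entire_coeffs_fact)
  fix k show "norm (coeff_J m k) \<le> 1 * 1 ^ k / fact k"
    unfolding coeff_J_def by (rule order.trans[OF norm_div_fact_le]) (simp add: norm_power)
qed

text \<open>Each step of the recurrence of \<open>Digamma\<close> adds 1/(k + 1), of norm at most 1.
  Linear growth is enough, since the factorials in \<open>coeff_T\<close> dominate it.\<close>

lemma norm_Digamma_nat_le:
  "norm (Digamma (of_nat (k + 1)) :: complex) \<le> norm (Digamma 1 :: complex) + real k"
proof (induction k)
  case (Suc k)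
  have "Digamma (of_nat (Suc k + 1) :: complex) = Digamma (of_nat (k + 1)) + 1 / of_nat (k + 1)"
    using Digamma_plus1[of "of_nat (k + 1) :: complex"] of_nat_neq_0[of k, where 'a = complex]
    by (simp add: add_ac)
  also have "norm \<dots> \<le> norm (Digamma (of_nat (k + 1)) :: complex) + 1"
    by (rule order.trans[OF norm_triangle_ineq], rule add_left_mono)
       (simp add: norm_divide del: of_nat_Suc of_nat_add)
  finally show ?case using Suc by simp
qed simp

lemma entire_coeff_T: "entire_coeffs (coeff_T m)"
proof (rule entire_coeffs_fact)
  fix k
  define A where "A = norm (Digamma 1 :: complex)"
  have A: "A \<ge> 0" by (simp add: A_def)
  have "norm (Digamma (of_nat (k + 1)) + Digamma (of_nat (m + k + 1)) :: complex)
     \<le> (A + real k) + (A + real (m + k))"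
    unfolding A_def by (rule order.trans[OF norm_triangle_ineq add_mono[OF norm_Digamma_nat_le norm_Digamma_nat_le]])
  also have "\<dots> = 2 * A + real m + 2 * real k" by simp
  \<comment> \<open>The linear bound is absorbed into a multiple of 2^k to fit the geometric shape
    that \<open>entire_coeffs_fact\<close> expects, with r = 2.\<close>
  also have "\<dots> \<le> (2 * A + real m) * 2 ^ k + 2 * 2 ^ k"
  proof (rule add_mono)
    show "2 * A + real m \<le> (2 * A + real m) * 2 ^ k"
      using mult_left_mono[of 1 "2 ^ k :: real" "2 * A + real m"] A by simp
    show "2 * real k \<le> 2 * 2 ^ k"
      using of_nat_less_two_power[of k, where 'a = real] by simp
  qed
  finally have "norm (Digamma (of_nat (k + 1)) + Digamma (of_nat (m + k + 1)) :: complex)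
     \<le> (2 * A + real m + 2) * 2 ^ k" by (simp only: distrib_right)
  then show "norm (coeff_T m k) \<le> (2 * A + real m + 2) * 2 ^ k / fact k"
    unfolding coeff_T_def
    by (intro order.trans[OF norm_div_fact_le] divide_right_mono)
       (simp_all only: norm_mult norm_power norm_minus_cancel norm_one power_one mult_1_right
          fact_ge_zero)
qed

lemma entire_coeff_S: "entire_coeffs (coeff_S m)"
  unfolding entire_coeffs_def
  by (intro allI summable_finite[of "{..<m}"]) (auto simp: coeff_S_def)

lemma Bessel_J_eq: "Bessel_J m z = bser (int m) (coeff_J m) z"
proof -
  have "(z / 2) ^ (2 * k + m) = (z / 2) ^ m * (z\<^sup>2 / 4) ^ k" for k
    by (simp add: power_add power_mult power_divide) (simp add: mult.commute)
  then have "Bessel_J m z = (\<Sum>k. (z / 2) ^ m * (coeff_J m k * (z\<^sup>2 / 4) ^ k))"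
    unfolding Bessel_J_def coeff_J_def by (simp add: mult_ac)
  then show ?thesis
    using entire_coeff_J[of m] by (simp add: bser_def pser_def suminf_mult entire_coeffs_def)
qed

lemma Bessel_Y_eq:
  "Bessel_Y m z = 2 / of_real pi * Ln (z / 2) * Bessel_J m z
     - 1 / of_real pi * (bser (- int m) (coeff_S m) z + bser (int m) (coeff_T m) z)"
proof -
  have "pser (coeff_S m) (z\<^sup>2 / 4) = (\<Sum>k<m. fact (m - k - 1) / fact k * (z\<^sup>2 / 4) ^ k)"
    unfolding pser_def by (subst suminf_finite[of "{..<m}"]) (auto simp: coeff_S_def)
  moreover have "pser (coeff_T m) (z\<^sup>2 / 4) =
     (\<Sum>k. (Digamma (of_nat (k + 1)) + Digamma (of_nat (m + k + 1))) *
                (- (z\<^sup>2 / 4)) ^ k / (fact k * fact (m + k)))"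
    unfolding pser_def coeff_T_def by (subst power_minus) (simp add: mult_ac)
  ultimately show ?thesis
    unfolding Bessel_Y_def bser_def by (simp add: algebra_simps)
qed

lemma coeff_J_rec: "of_nat k * of_int (int k + int m) * coeff_J m k + case_nat 0 (coeff_J m) k = 0"
proof (cases k)
  case (Suc i)
  have "of_nat (Suc i + m) \<noteq> (0 :: complex)" by (simp del: of_nat_Suc of_nat_add)
  then show ?thesis using of_nat_neq_0[of i, where 'a = complex]
    unfolding Suc coeff_J_def
    by (simp add: divide_simps fact_reduce[of "Suc _"] del: of_nat_Suc of_nat_add) (simp add: algebra_simps)
qed simp

text \<open>The digamma increments 1/k + 1/(k + m), multiplied by k(k + m), become 2k + m; what
  remains is killed by the recurrence of \<open>coeff_J\<close>. The defect is therefore four times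
  the coefficient sequence of \<open>euler_J\<close>. At k = 0 the left side vanishes but (2k + m)
  \<open>coeff_J m k\<close> is m/m!, hence the correction.\<close>

lemma coeff_T_rec:
  "4 * (of_nat k * of_int (int k + int m) * coeff_T m k + case_nat 0 (coeff_T m) k) =
   4 * (of_int (2 * int k + int m) * coeff_J m k) + (if k = 0 then - (4 * of_nat m / fact m) else 0)"
proof (cases k)
  case 0
  then show ?thesis by (simp add: coeff_J_def)
next
  case (Suc i)
  define a b :: complex where "a = of_nat (Suc i)" and "b = of_nat (Suc i + m)"
  have ab: "a \<noteq> 0" "b \<noteq> 0" by (auto simp: a_def b_def simp del: of_nat_Suc of_nat_add)
  define P Q :: complex where "P = Digamma a" and "Q = Digamma b"
  define f g :: complex where "f = fact i" and "g = fact (i + m)"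
  have d: "Digamma (a + 1) = P + 1 / a" "Digamma (b + 1) = Q + 1 / b"
    unfolding P_def Q_def by (intro Digamma_plus1 ab)+
  have e: "of_nat (Suc i + 1) = a + 1" "of_nat (m + Suc i + 1) = b + 1"
      "fact (Suc i) = a * f" "fact (m + Suc i) = b * g"
    by (simp_all add: a_def b_def f_def g_def add_ac)
  have T1: "coeff_T m (Suc i) = ((P + 1 / a) + (Q + 1 / b)) * (-1) ^ Suc i / ((a * f) * (b * g))"
    unfolding coeff_T_def e d ..
  have T0: "coeff_T m i = (P + Q) * (-1) ^ i / (f * g)"
    unfolding coeff_T_def P_def Q_def a_def b_def f_def g_def by (simp add: add_ac)
  have J1: "coeff_J m (Suc i) = (-1) ^ Suc i / ((a * f) * (b * g))"
    unfolding coeff_J_def a_def b_def f_def g_def by (simp add: add_ac)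
  have n: "of_nat (Suc i) = a" "of_int (int (Suc i) + int m) = b"
     "of_int (2 * int (Suc i) + int m) = a + b"
    by (simp_all add: a_def b_def)
  have alg: "4 * (a * b * (((P + 1 / a) + (Q + 1 / b)) * (- s) / ((a * f) * (b * g))) + (P + Q) * s / (f * g)) =
    4 * ((a + b) * (- s / ((a * f) * (b * g))))" for s
  proof -
    \<comment> \<open>With the reciprocals as variables subject to a u = 1 and b v = 1, the claim is
      a polynomial identity.\<close>
    define u v w where "u = 1 / a" and "v = 1 / b" and "w = 1 / (f * g)"
    have "a * u = 1" "b * v = 1" using ab by (simp_all add: u_def v_def)
    then have "4 * (a * b * (((P + u) + (Q + v)) * (- s) * (u * v * w)) + (P + Q) * s * w) =
        4 * ((a + b) * (- s * (u * v * w)))"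
      by algebra
    then show ?thesis by (simp add: u_def v_def w_def mult_ac)
  qed
  show ?thesis
    unfolding Suc n T1 J1 nat.case T0 using alg by simp
qed

text \<open>The recurrence can fail only where the sequence breaks off: at k = m the factor k - m is
  zero, and for m > 0 the shifted term leaves 4/(m - 1)!. This is exactly the correction term of
  \<open>coeff_T_rec\<close> with the opposite sign.\<close>

lemma coeff_S_rec:
  "4 * (of_nat k * of_int (int k + - int m) * coeff_S m k + case_nat 0 (coeff_S m) k) =
   (if k = m then 4 * of_nat m / fact m else 0)"
proof (cases k)
  case (Suc i)
  consider "Suc i < m" | "Suc i = m" | "Suc i > m" by linarith
  then show ?thesis
  proof cases
    case 1
    then obtain j where m: "m = Suc (Suc i) + j" by (metis Suc_leI le_Suc_ex)
    have "of_nat (Suc i) \<noteq> (0 :: complex)" by (simp del: of_nat_Suc)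
    then show ?thesis unfolding Suc m coeff_S_def
      by (simp add: divide_simps del: of_nat_Suc) (simp add: algebra_simps)
  next
    case 2
    then show ?thesis unfolding Suc coeff_S_def 
      by (auto simp: divide_simps simp del: of_nat_Suc)
  next
    case 3
    then show ?thesis unfolding Suc coeff_S_def by simp
  qed
qed (simp add: coeff_S_def)

section \<open>J and Y as solutions of Bessel's equation\<close>

text \<open>Bessel's equation as a first-order system: \<^term>\<open>g\<close> is $\vartheta f$.\<close>

definition bessel_solution ::
    "nat \<Rightarrow> complex set \<Rightarrow> (complex \<Rightarrow> complex) \<Rightarrow> (complex \<Rightarrow> complex) \<Rightarrow> bool" where
  "bessel_solution m S f g \<longleftrightarrow> (\<forall>z\<in>S. (f has_field_derivative g z / z) (at z) \<and>
     (g has_field_derivative (of_nat m ^ 2 - z\<^sup>2) * f z / z) (at z))"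

definition euler_J :: "nat \<Rightarrow> complex \<Rightarrow> complex" where
  "euler_J m = bser (int m) (euler_coeffs (int m) (coeff_J m))"

definition euler_S :: "nat \<Rightarrow> complex \<Rightarrow> complex" where
  "euler_S m = bser (- int m) (euler_coeffs (- int m) (coeff_S m))"

definition euler_T :: "nat \<Rightarrow> complex \<Rightarrow> complex" where
  "euler_T m = bser (int m) (euler_coeffs (int m) (coeff_T m))"

text \<open>The first \<open>Bessel_J\<close> comes from the logarithm, whose image under the Euler
  operator is 1.\<close>

definition euler_Y :: "nat \<Rightarrow> complex \<Rightarrow> complex" where
  "euler_Y m z = 2 / of_real pi * (Bessel_J m z + Ln (z / 2) * euler_J m z)
     - 1 / of_real pi * (euler_S m z + euler_T m z)"

lemma bessel_solution_J: "bessel_solution m (- {0}) (Bessel_J m) (euler_J m)"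
  unfolding bessel_solution_def
proof (intro ballI conjI)
  fix z :: complex assume "z \<in> - {0}"
  then have z: "z \<noteq> 0" by simp
  show "(Bessel_J m has_field_derivative euler_J m z / z) (at z)"
    using bser_deriv[OF entire_coeff_J z] unfolding euler_J_def Bessel_J_eq[abs_def] .
  have e: "bser (int m) (euler_coeffs (int m) (euler_coeffs (int m) (coeff_J m))) z
      = (of_nat m ^ 2 - z\<^sup>2) * Bessel_J m z"
    using bser_bessel_operator[OF entire_coeff_J, of "int m" m z]
    unfolding coeff_J_rec Bessel_J_eq by (simp add: bser_def pser_def algebra_simps)
  show "(euler_J m has_field_derivative (of_nat m ^ 2 - z\<^sup>2) * Bessel_J m z / z) (at z)"
    using bser_deriv[OF euler_coeffs_eq(1)[OF entire_coeff_J] z, of "int m" "int m" m]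
    unfolding e euler_J_def .
qed

text \<open>Applying the Euler operator twice to Ln(z/2) J gives an extra 2 \<open>euler_J\<close>.
  With its prefactor 2/pi this cancels the joint defect 4 \<open>euler_J\<close> of the two sums,
  which enter with -1/pi.\<close>

lemma bessel_solution_Y: "bessel_solution m (- \<real>\<^sub>\<le>\<^sub>0) (Bessel_Y m) (euler_Y m)"
  unfolding bessel_solution_def
proof (intro ballI conjI)
  fix z :: complex assume zS: "z \<in> - \<real>\<^sub>\<le>\<^sub>0"
  then have z: "z \<noteq> 0" by auto
  have z2: "z / 2 \<notin> \<real>\<^sub>\<le>\<^sub>0" using zS by (auto simp: complex_nonpos_Reals_iff)
  have J: "(Bessel_J m has_field_derivative euler_J m z / z) (at z)"
      "(euler_J m has_field_derivative (of_nat m ^ 2 - z\<^sup>2) * Bessel_J m z / z) (at z)"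
    using bessel_solution_J[of m] z by (auto simp: bessel_solution_def)
  have L: "((\<lambda>z. Ln (z / 2)) has_field_derivative 1 / z) (at z)"
    using z z2 by (auto intro!: derivative_eq_intros simp: field_simps)
  note D = J L
    bser_deriv[OF entire_coeff_S z, of "- int m" m, folded euler_S_def]
    bser_deriv[OF entire_coeff_T z, of "int m" m, folded euler_T_def]
    bser_deriv[OF euler_coeffs_eq(1)[OF entire_coeff_S] z, of "- int m" "- int m" m, folded euler_S_def]
    bser_deriv[OF euler_coeffs_eq(1)[OF entire_coeff_T] z, of "int m" "int m" m, folded euler_T_def]
  define S2 where "S2 = bser (- int m) (euler_coeffs (- int m) (euler_coeffs (- int m) (coeff_S m))) z"
  define T2 where "T2 = bser (int m) (euler_coeffs (int m) (euler_coeffs (int m) (coeff_T m))) z"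
  \<comment> \<open>The defect of the S-part. Its only coefficient sits at k = m, which lifts the
    power from -m to m, so it can cancel against the T-part.\<close>
  define e where "e = 4 * of_nat m / fact m * (z / 2) ^ m"
  have S2: "S2 + (z\<^sup>2 - of_nat m ^ 2) * bser (- int m) (coeff_S m) z = e"
  proof -
    have "(z / 2) powi (- int m) * (z\<^sup>2 / 4) ^ m = (z / 2) ^ m"
    proof -
      have "z\<^sup>2 / 4 = z / 2 * (z / 2)" by (simp add: power2_eq_square)
      then have "(z\<^sup>2 / 4) ^ m = (z / 2) ^ m * (z / 2) ^ m"
        by (simp only: power_mult_distrib)
      then show ?thesis
        using z by (simp add: power_int_minus)
    qed
    then show ?thesis
    using bser_bessel_operator[OF entire_coeff_S, of "- int m" m z]
    unfolding coeff_S_rec S2_def e_def by (simp add: bser_def pser_single(2) mult.left_commute)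
  qed
  have T2: "T2 + (z\<^sup>2 - of_nat m ^ 2) * bser (int m) (coeff_T m) z = 4 * euler_J m z - e"
  proof -
    have E: "entire_coeffs (euler_coeffs (int m) (coeff_J m))"
      by (rule euler_coeffs_eq(1)[OF entire_coeff_J])
    show ?thesis
    using bser_bessel_operator[OF entire_coeff_T, of "int m" m z]
    unfolding coeff_T_rec T2_def e_def bser_def euler_J_def
       entire_coeffs_add(2)[OF entire_coeffs_cmult(1)[OF E] pser_single(1)]
       entire_coeffs_cmult(2)[OF E] pser_single(2)
    by (simp add: algebra_simps)
  qed
  have "(Bessel_Y m has_field_derivative
      2 / of_real pi * (1 / z * Bessel_J m z + euler_J m z / z * Ln (z / 2))
      - 1 / of_real pi * (euler_S m z / z + euler_T m z / z)) (at z)"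
    unfolding Bessel_Y_eq[abs_def] mult.assoc[of "2 / of_real pi"]
    by (intro DERIV_diff DERIV_cmult DERIV_add DERIV_mult D)
  also have "2 / of_real pi * (1 / z * Bessel_J m z + euler_J m z / z * Ln (z / 2))
      - 1 / of_real pi * (euler_S m z / z + euler_T m z / z) = euler_Y m z / z"
    unfolding euler_Y_def by (simp add: diff_divide_distrib add_divide_distrib mult.commute)
  finally show "(Bessel_Y m has_field_derivative euler_Y m z / z) (at z)" .
  define M where "M = of_nat m ^ 2 - z\<^sup>2"
  define X where "X = bser (- int m) (coeff_S m) z + bser (int m) (coeff_T m) z"
  have ST: "S2 + T2 = 4 * euler_J m z + M * X"
  proof -
    have "S2 = e + M * bser (- int m) (coeff_S m) z"
      "T2 = 4 * euler_J m z - e + M * bser (int m) (coeff_T m) z"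
      using S2 T2 by (simp_all add: M_def algebra_simps)
    then show ?thesis by (simp add: X_def distrib_left)
  qed
  have "(euler_Y m has_field_derivative
      2 / of_real pi * (euler_J m z / z + (1 / z * euler_J m z + M * Bessel_J m z / z * Ln (z / 2)))
      - 1 / of_real pi * (S2 / z + T2 / z)) (at z)"
    unfolding euler_Y_def[abs_def] S2_def T2_def M_def
    by (intro DERIV_diff DERIV_cmult DERIV_add DERIV_mult D)
  also have "2 / of_real pi * (euler_J m z / z + (1 / z * euler_J m z + M * Bessel_J m z / z * Ln (z / 2)))
      - 1 / of_real pi * (S2 / z + T2 / z) =
      (2 / of_real pi * (2 * euler_J m z + Ln (z / 2) * (M * Bessel_J m z))
      - 1 / of_real pi * (S2 + T2)) / z"
    by (simp add: diff_divide_distrib add_divide_distrib mult.commute)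
  also have "2 / of_real pi * (2 * euler_J m z + Ln (z / 2) * (M * Bessel_J m z))
      - 1 / of_real pi * (S2 + T2) = M * Bessel_Y m z"
  proof -
    have "2 * q * (2 * d + l * (M * j)) - q * (4 * d + M * X) = M * (2 * q * l * j - q * X)"
      for q d l j :: complex by algebra
    from this[of "1 / of_real pi"] show ?thesis
      unfolding ST Bessel_Y_eq X_def by simp
  qed
  finally show "(euler_Y m has_field_derivative (of_nat m ^ 2 - z\<^sup>2) * Bessel_Y m z / z) (at z)"
    unfolding M_def .
qed

lemma bessel_solution_subset: "bessel_solution m S f g \<Longrightarrow> T \<subseteq> S \<Longrightarrow> bessel_solution m T f g"
  by (auto simp: bessel_solution_def)

lemma bessel_solution_add_cmult:
  assumes "bessel_solution m S f g" "bessel_solution m S h k"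
  shows "bessel_solution m S (\<lambda>z. f z + a * h z) (\<lambda>z. g z + a * k z)"
  unfolding bessel_solution_def
proof (intro ballI conjI)
  fix z assume z: "z \<in> S"
  note D = assms[unfolded bessel_solution_def, THEN bspec, OF z]
  note D = D(1)[THEN conjunct1] D(1)[THEN conjunct2] D(2)[THEN conjunct1] D(2)[THEN conjunct2]
  show "((\<lambda>z. f z + a * h z) has_field_derivative (g z + a * k z) / z) (at z)"
    by (rule derivative_eq_intros D refl)+ (simp add: add_divide_distrib)
  show "((\<lambda>z. g z + a * k z) has_field_derivative
          (of_nat m ^ 2 - z\<^sup>2) * (f z + a * h z) / z) (at z)"
    by (rule derivative_eq_intros D refl)+ (simp add: add_divide_distrib distrib_left distrib_right mult_ac)
qed

section \<open>Wronskians\<close>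

text \<open>Since g and k are Euler derivatives, this is z times the usual Wronskian, which explains
  a constant instead of a multiple of 1/z.\<close>

lemma bessel_wronskian_constant:
  assumes "bessel_solution m S f g" "bessel_solution m S h k" "open S" "connected S"
  shows "(\<lambda>z. f z * k z - g z * h z) constant_on S"
proof (rule has_field_derivative_0_imp_constant_on)
  fix z assume z: "z \<in> S"
  note D = assms(1,2)[unfolded bessel_solution_def, THEN bspec, OF z]
  note D = D(1)[THEN conjunct1] D(1)[THEN conjunct2] D(2)[THEN conjunct1] D(2)[THEN conjunct2]
  show "((\<lambda>z. f z * k z - g z * h z) has_field_derivative 0) (at z)"
    by (rule derivative_eq_intros D refl)+ simp
qed (use assms in auto)

lemma slit_plane: "open (- \<real>\<^sub>\<le>\<^sub>0 :: complex set)" "connected (- \<real>\<^sub>\<le>\<^sub>0 :: complex set)"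
proof -
  have "- \<real>\<^sub>\<le>\<^sub>0 = - (complex_of_real ` {..0})"
    by (auto simp: complex_slot_left_eq complex_nonpos_Reals_iff)
  then show "connected (- \<real>\<^sub>\<le>\<^sub>0 :: complex set)"
    using starlike_slotted_complex_plane_left[of 0] starlike_imp_connected by metis
qed auto

text \<open>The logarithms cancel in the Wronskian, so its constant value can be read off at $z = 0$.\<close>

lemma wronskian_J_Y:
  assumes "z \<notin> \<real>\<^sub>\<le>\<^sub>0"
  shows "Bessel_J m z * euler_Y m z - euler_J m z * Bessel_Y m z = 2 / of_real pi"
proof -
  have J: "bessel_solution m (- \<real>\<^sub>\<le>\<^sub>0) (Bessel_J m) (euler_J m)"
    by (rule bessel_solution_subset[OF bessel_solution_J]) auto
  define j j1 s s1 t t1 where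
    "j = (\<lambda>z :: complex. pser (coeff_J m) (z\<^sup>2 / 4))" and
    "j1 = (\<lambda>z :: complex. pser (euler_coeffs (int m) (coeff_J m)) (z\<^sup>2 / 4))" and
    "s = (\<lambda>z :: complex. pser (coeff_S m) (z\<^sup>2 / 4))" and
    "s1 = (\<lambda>z :: complex. pser (euler_coeffs (- int m) (coeff_S m)) (z\<^sup>2 / 4))" and
    "t = (\<lambda>z :: complex. pser (coeff_T m) (z\<^sup>2 / 4))" and
    "t1 = (\<lambda>z :: complex. pser (euler_coeffs (int m) (coeff_T m)) (z\<^sup>2 / 4))"
  \<comment> \<open>The Wronskian off the cut after all cancellations: the factor (z/2)^(-m) of the
    S-part meets (z/2)^m from J, so no singularity is left and E extends continuously to 0.\<close>
  define E where "E = (\<lambda>z. ((z / 2) ^ (2 * m) * (2 * j z ^ 2 - (j z * t1 z - j1 z * t z))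
      - (j z * s1 z - j1 z * s z)) / of_real pi)"
  have EW: "Bessel_J m z * euler_Y m z - euler_J m z * Bessel_Y m z = E z"
    if "z \<notin> \<real>\<^sub>\<le>\<^sub>0" for z
  proof -
    have z: "z \<noteq> 0" using that by auto
    define u where "u = (z / 2) ^ m"
    have u: "u \<noteq> 0" using z by (simp add: u_def)
    have p: "(z / 2) powi int m = u" "(z / 2) powi (- int m) = inverse u"
      by (simp_all add: u_def power_int_minus)
    have b: "bser (int m) c z = u * pser c (z\<^sup>2 / 4)" "bser (- int m) c z = pser c (z\<^sup>2 / 4) / u" for c
      unfolding bser_def p using u by (simp_all add: divide_simps)
    have e: "Bessel_J m z = u * j z" "euler_J m z = u * j1 z"
      "bser (int m) (coeff_T m) z = u * t z" "euler_T m z = u * t1 z"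
      "bser (- int m) (coeff_S m) z = s z / u" "euler_S m z = s1 z / u"
      unfolding Bessel_J_eq euler_J_def euler_T_def euler_S_def b j_def j1_def t_def t1_def s_def s1_def
      by (rule refl)+
    have "(z / 2) ^ (2 * m) = u\<^sup>2" unfolding u_def by (rule power_even_eq)
    moreover have "u * a * (2 / p * (u * a + l * (u * a1)) - 1 / p * (b1 / u + u * d1)) -
        u * a1 * (2 / p * l * (u * a) - 1 / p * (b / u + u * d)) =
        (u\<^sup>2 * (2 * a\<^sup>2 - (a * d1 - a1 * d)) - (a * b1 - a1 * b)) / p"
      for a a1 b b1 d d1 l p :: complex
    proof -
      define v q where "v = 1 / u" and "q = 1 / p"
      have "u * v = 1" using u by (simp add: v_def)
      then have "u * a * (2 * q * (u * a + l * (u * a1)) - q * (b1 * v + u * d1)) -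
          u * a1 * (2 * q * l * (u * a) - q * (b * v + u * d)) =
          (u\<^sup>2 * (2 * a\<^sup>2 - (a * d1 - a1 * d)) - (a * b1 - a1 * b)) * q"
        by algebra
      then show ?thesis by (simp add: v_def q_def)
    qed
    ultimately show ?thesis
      unfolding E_def Bessel_Y_eq euler_Y_def e by simp
  qed
  have "continuous_on UNIV E"
    unfolding E_def j_def j1_def s_def s1_def t_def t1_def
    by (intro continuous_intros entire_coeff_J entire_coeff_S entire_coeff_T euler_coeffs_eq(1)) auto
  then have E0: "isCont E 0" by (simp add: continuous_on_eq_continuous_at)
  obtain c where "\<forall>z \<in> - \<real>\<^sub>\<le>\<^sub>0. Bessel_J m z * euler_Y m z - euler_J m z * Bessel_Y m z = c"
    using bessel_wronskian_constant[OF J bessel_solution_Y slit_plane] unfolding constant_on_def ..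
  then have c: "E z = c" if "z \<notin> \<real>\<^sub>\<le>\<^sub>0" for z
    unfolding EW[OF that, symmetric] using that by blast
  \<comment> \<open>The origin lies on the cut, so E(0) is reached as a limit along the points 1/(i
    + 1), where E is known to be c.\<close>
  have "(\<lambda>i. of_real (inverse (real (Suc i))) :: complex) \<longlonglongrightarrow> 0"
    using tendsto_of_real[OF LIMSEQ_inverse_real_of_nat, where 'a = complex] by (simp only: of_real_0)
  then have "(\<lambda>i. E (of_real (inverse (real (Suc i))))) \<longlonglongrightarrow> E 0"
    by (rule isCont_tendsto_compose[OF E0])
  moreover have "E (of_real (inverse (real (Suc i)))) = c" for i
    by (rule c) (simp add: complex_nonpos_Reals_iff del: of_nat_Suc of_real_inverse)
  ultimately have "E 0 = c" by (simp add: LIMSEQ_const_iff)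
  \<comment> \<open>For m = 0 the S-part is absent and 2 j(0)^2 = 2 gives the value. For m > 0 the
    factor (z/2)^(2m) vanishes, and the S-part contributes 2m (m - 1)!/m! = 2.\<close>
  moreover have "E 0 = 2 / of_real pi"
  proof (cases "m = 0")
    case True
    then show ?thesis
      by (simp add: E_def j_def j1_def s_def s1_def t_def t1_def coeff_J_def coeff_S_def)
  next
    case False
    then have "fact m = of_nat m * (fact (m - 1) :: complex)" by (simp add: fact_reduce)
    with False show ?thesis
      by (simp add: E_def j_def j1_def s_def s1_def t_def t1_def coeff_J_def coeff_S_def)
  qed
  ultimately show ?thesis using EW[OF assms] c[OF assms] by simp
qed

section \<open>Real values on the real axis\<close>

lemma bser_Reals:
  assumes "entire_coeffs c" "\<And>k. c k \<in> \<real>" "x \<in> \<real>"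
  shows "bser p c x \<in> \<real>"
proof -
  have "(x / 2) powi p \<in> \<real>"
  proof -
    obtain r where "x = of_real r" using assms(3) by (rule Reals_cases)
    then have "(x / 2) powi p = of_real ((r / 2) powi p)" by simp
    then show ?thesis by (simp only: Reals_of_real)
  qed
  then show ?thesis
    unfolding bser_def
    by (intro Reals_mult pser_Reals assms Reals_divide Reals_power) auto
qed

lemma fact_Reals: "fact k \<in> (\<real> :: complex set)"
  by (metis Reals_of_nat of_nat_fact)

lemma Bessel_J_Reals: "x \<in> \<real> \<Longrightarrow> Bessel_J m x \<in> \<real>"
  unfolding Bessel_J_eq
  by (intro bser_Reals entire_coeff_J)
     (auto simp: coeff_J_def intro!: Reals_mult Reals_power Reals_divide fact_Reals)

lemma Bessel_Y_Reals:
  assumes "x > 0"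
  shows "Bessel_Y m (of_real x) \<in> \<real>"
proof -
  have "coeff_T m k \<in> \<real>" for k
  proof -
    have "Digamma (of_nat (i + 1) :: complex) \<in> \<real>" for i
      by (rule Polygamma_Real) (auto simp del: of_nat_add of_nat_Suc)
    from this[of k] this[of "m + k"] show ?thesis
      unfolding coeff_T_def
      by (intro Reals_divide Reals_mult Reals_add Reals_power fact_Reals) auto
  qed
  then have "bser (int m) (coeff_T m) (of_real x) \<in> \<real>"
    by (intro bser_Reals entire_coeff_T) auto
  moreover have "bser (- int m) (coeff_S m) (of_real x) \<in> \<real>"
    by (intro bser_Reals entire_coeff_S) (auto simp: coeff_S_def intro: Reals_divide fact_Reals)
  moreover have "Ln (of_real x / 2) \<in> \<real>"
    using assms Ln_of_real[of "x / 2"] by simp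
  ultimately show ?thesis
    unfolding Bessel_Y_eq using Bessel_J_Reals[of "of_real x" m]
    by (intro Reals_diff Reals_mult Reals_add Reals_divide) auto
qed

section \<open>The zeros of J are real\<close>

lemma continuous_on_bser:
  assumes "entire_coeffs c" "continuous_on A f"
  shows "continuous_on A (\<lambda>x. bser (int p) c (f x))"
  unfolding bser_def power_int_of_nat by (intro continuous_intros assms) auto

text \<open>Without the factor (z/2)^m, the value at 0 is 1/m!. This rules out that J vanishes on a
  whole segment ending at 0.\<close>

lemma Bessel_J_eventually_nonzero: "eventually (\<lambda>z. Bessel_J m z \<noteq> 0) (at 0)"
proof -
  have "isCont (\<lambda>z. pser (coeff_J m) (z\<^sup>2 / 4)) 0"
    using continuous_on_pser[OF entire_coeff_J, of UNIV "\<lambda>z. z\<^sup>2 / 4" m]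
    by (simp add: continuous_on_eq_continuous_at continuous_intros)
  then have "(\<lambda>z. pser (coeff_J m) (z\<^sup>2 / 4)) \<midarrow>0\<rightarrow> coeff_J m 0"
    by (simp add: isCont_def)
  moreover have "coeff_J m 0 \<noteq> 0" by (simp add: coeff_J_def)
  ultimately have "eventually (\<lambda>z. pser (coeff_J m) (z\<^sup>2 / 4) \<noteq> 0) (at 0)"
    by (rule tendsto_imp_eventually_ne)
  then show ?thesis
    using eventually_neq_at_within[of 0 0 UNIV] unfolding Bessel_J_eq bser_def by eventually_elim simp
qed

text \<open>A monotone function with equal end values is constant. Differentiability is asked only
  inside the interval, because the derivative used later carries a factor 1/x.\<close>

lemma monotone_const_imp_DERIV_zero:
  fixes f f' :: "real \<Rightarrow> real"
  assumes "continuous_on {a..b} f" "f a = f b"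
    and "\<And>x. a < x \<Longrightarrow> x < b \<Longrightarrow> (f has_real_derivative f' x) (at x)"
    and "\<And>x. a < x \<Longrightarrow> x < b \<Longrightarrow> f' x \<ge> 0"
    and "a < x" "x < b"
  shows "f' x = 0"
proof -
  have mono: "f u \<le> f v" if "a \<le> u" "u \<le> v" "v \<le> b" for u v
  proof (rule DERIV_nonneg_imp_increasing_open[of u v f])
    show "continuous_on {u..v} f"
      using that by (intro continuous_on_subset[OF assms(1)]) auto
    show "\<exists>d. (f has_real_derivative d) (at y) \<and> 0 \<le> d" if "u < y" "y < v" for y
      using that \<open>a \<le> u\<close> \<open>v \<le> b\<close> by (intro exI[of _ "f' y"] conjI assms(3,4)) auto
  qed (use that in auto)
  have const: "f y = f a" if "a < y" "y < b" for y
    using mono[of a y] mono[of y b] that assms(2) by auto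
  have "(f has_real_derivative 0) (at x)"
    by (rule has_field_derivative_transform_within_open[of "\<lambda>_. f a" _ _ "{a<..<b}"])
       (use assms(5,6) const in auto)
  then show ?thesis using DERIV_unique assms(3,5,6) by blast
qed

text \<open>
  For $g(x) = (\vartheta J)(ax)\,\overline{J(ax)}$ one has
  $x g' = (m^2 - a^2x^2)|J(ax)|^2 + |(\vartheta J)(ax)|^2$ and $g(0) = g(1) = 0$. If $a$ is not real, then
  $\mathrm{Im}\,g$ (when $a^2$ is not real) or $\mathrm{Re}\,g$ (when $a^2 < 0$) is monotone, hence constant.
\<close>

lemma Bessel_J_zero_real:
  assumes "Bessel_J m a = 0" "a \<noteq> 0"
  shows "a \<in> \<real>"
proof (rule ccontr)
  assume nr: "a \<notin> \<real>"
  define g where "g = (\<lambda>x. euler_J m (of_real x * a) * cnj (Bessel_J m (of_real x * a)))"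
  define g' where "g' = (\<lambda>x. ((of_nat m ^ 2 - (of_real x * a)\<^sup>2) * of_real (norm (Bessel_J m (of_real x * a)) ^ 2)
      + of_real (norm (euler_J m (of_real x * a)) ^ 2)) / of_real x)"
  have g: "(g has_vector_derivative g' x) (at x)" if "x > 0" for x
  proof -
    have xa: "of_real x * a \<noteq> 0" using that assms by simp
    have D: "(Bessel_J m has_field_derivative euler_J m (of_real x * a) / (of_real x * a)) (at (of_real x * a))"
     "(euler_J m has_field_derivative (of_nat m ^ 2 - (of_real x * a)\<^sup>2) * Bessel_J m (of_real x * a) / (of_real x * a)) (at (of_real x * a))"
      using bessel_solution_J[of m] xa by (auto simp: bessel_solution_def)
    have l: "((\<lambda>x. of_real x * a) has_vector_derivative a) (at x)"
      by (auto intro!: derivative_eq_intros)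
    have V: "((\<lambda>x. F (of_real x * a)) has_vector_derivative d / of_real x) (at x)"
      if "(F has_field_derivative d / (of_real x * a)) (at (of_real x * a))" for F d
      using field_vector_diff_chain_at[OF l that] xa by (simp add: o_def)
    have "(g has_vector_derivative
        euler_J m (of_real x * a) * cnj (euler_J m (of_real x * a) / of_real x) +
        (of_nat m ^ 2 - (of_real x * a)\<^sup>2) * Bessel_J m (of_real x * a) / of_real x
          * cnj (Bessel_J m (of_real x * a))) (at x)"
      unfolding g_def
      by (intro has_vector_derivative_mult has_vector_derivative_cnj V D)
    moreover have "euler_J m (of_real x * a) * cnj (euler_J m (of_real x * a) / of_real x) +
        (of_nat m ^ 2 - (of_real x * a)\<^sup>2) * Bessel_J m (of_real x * a) / of_real x
          * cnj (Bessel_J m (of_real x * a)) = g' x"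
      unfolding g'_def complex_norm_square using that by (simp add: field_simps)
    ultimately show ?thesis by simp
  qed
  have cont: "continuous_on {0..1} g"
    unfolding g_def Bessel_J_eq euler_J_def
    by (intro continuous_intros continuous_on_bser entire_coeff_J euler_coeffs_eq(1))
  \<comment> \<open>At 0 the factor \<open>euler_J\<close> vanishes: for m > 0 through the power of
    z, for m = 0 because the leading eigenvalue 2k + m is 0. At 1 the assumed zero of J
    enters.\<close>
  have ends: "g 0 = 0" "g 1 = 0"
    using assms(1) by (auto simp: g_def euler_J_def bser_def power_int_0_left_if)
  \<comment> \<open>The real-linear functional h unifies the two cases: it is a signed imaginary
    part or the real part.\<close>
  have "\<exists>h :: complex \<Rightarrow> real. bounded_linear h \<and> (\<forall>x>0. h (g' x) \<ge> 0 \<and>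
     (h (g' x) = 0 \<longrightarrow> Bessel_J m (of_real x * a) = 0))"
  proof (cases "Im (a\<^sup>2) = 0")
    case False
    define r where "r = - sgn (Im (a\<^sup>2))"
    have h: "r * Im (g' x) = \<bar>Im (a\<^sup>2)\<bar> * x * norm (Bessel_J m (of_real x * a)) ^ 2" if "x > 0" for x
    proof -
      have "Im (g' x) = - Im (a\<^sup>2) * x * norm (Bessel_J m (of_real x * a)) ^ 2"
        unfolding g'_def using that
        by (simp add: Im_divide_of_real power_mult_distrib power2_eq_square)
      then show ?thesis by (simp add: r_def abs_sgn mult_ac)
    qed
    show ?thesis
      by (rule exI[of _ "\<lambda>w. r * Im w"])
         (use False in \<open>auto simp: h intro!: bounded_linear_const_mult bounded_linear_Im\<close>)
  next
    case True
    \<comment> \<open>Im(a^2) = 2 Re(a) Im(a), and Im(a) is nonzero.\<close>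
    then have "Re a = 0" using nr by (auto simp: power2_eq_square complex_is_Real_iff)
    then have a2: "Re (a\<^sup>2) < 0" using assms(2)
      by (auto simp: power2_eq_square complex_eq_iff zero_less_mult_iff)
    have h: "Re (g' x) = ((real m ^ 2 - x\<^sup>2 * Re (a\<^sup>2)) * norm (Bessel_J m (of_real x * a)) ^ 2
       + norm (euler_J m (of_real x * a)) ^ 2) / x" for x
    proof -
      have "(of_nat m ^ 2 - (of_real x * a)\<^sup>2 :: complex) = of_real (real m ^ 2 - x\<^sup>2 * Re (a\<^sup>2))"
        using True by (simp add: complex_eq_iff power_mult_distrib)
      then show ?thesis unfolding g'_def 
        by (simp only: flip: of_real_mult of_real_add of_real_divide) simp
    qed
    have pos: "real m ^ 2 - x\<^sup>2 * Re (a\<^sup>2) > 0" if "x > 0" for x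
    proof -
      have "x\<^sup>2 * Re (a\<^sup>2) < 0" using that a2 by (simp add: mult_pos_neg)
      then show ?thesis using zero_le_power2[of "real m"] by linarith
    qed
    show ?thesis
    proof (intro exI[of _ Re] conjI allI impI bounded_linear_Re)
      fix x :: real assume x: "x > 0"
      show "0 \<le> Re (g' x)"
        unfolding h using pos[OF x] x by (intro divide_nonneg_pos add_nonneg_nonneg mult_nonneg_nonneg) auto
      assume "Re (g' x) = 0"
      then have "(real m ^ 2 - x\<^sup>2 * Re (a\<^sup>2)) * norm (Bessel_J m (of_real x * a)) ^ 2
          + norm (euler_J m (of_real x * a)) ^ 2 = 0"
        using x unfolding h by simp
      then have "(real m ^ 2 - x\<^sup>2 * Re (a\<^sup>2)) * norm (Bessel_J m (of_real x * a)) ^ 2 = 0"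
        using pos[OF x] by (subst (asm) add_nonneg_eq_0_iff) auto
      then show "Bessel_J m (of_real x * a) = 0" using pos[OF x] by auto
    qed
  qed
  then obtain h :: "complex \<Rightarrow> real" where h: "bounded_linear h"
      "\<And>x. x > 0 \<Longrightarrow> h (g' x) \<ge> 0" "\<And>x. x > 0 \<Longrightarrow> h (g' x) = 0 \<Longrightarrow> Bessel_J m (of_real x * a) = 0"
    by blast
  have zero: "Bessel_J m (of_real x * a) = 0" if "0 < x" "x < 1" for x
  proof (rule h(3)[OF that(1)], rule monotone_const_imp_DERIV_zero[where a = 0 and b = 1
      and f = "\<lambda>x. h (g x)" and f' = "\<lambda>x. h (g' x)"])
    show "continuous_on {0..1} (\<lambda>x. h (g x))"
      by (rule bounded_linear.continuous_on[OF h(1) cont])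
    show "((\<lambda>x. h (g x)) has_real_derivative h (g' x)) (at x)" if "0 < x" for x
      using bounded_linear.has_vector_derivative[OF h(1) g[OF that]]
      by (simp add: has_real_derivative_iff_has_vector_derivative)
  qed (use that h(2) ends in auto)
  \<comment> \<open>J vanishes on the open segment from 0 to a, which accumulates at 0, where J is
    eventually nonzero.\<close>
  have "filterlim (\<lambda>x. of_real x * a) (at 0) (at_right 0)"
    using assms(2) 
    by (intro filterlim_atI tendsto_eq_intros) (auto simp: eventually_at_filter intro!: tendsto_eq_intros)
  from eventually_compose_filterlim[OF Bessel_J_eventually_nonzero this]
  have "eventually (\<lambda>x. Bessel_J m (of_real x * a) \<noteq> 0) (at_right 0)" .
  moreover have "eventually (\<lambda>x. x \<in> {0<..<1}) (at_right (0 :: real))"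
    by (rule eventually_at_right_real) simp
  ultimately have "eventually (\<lambda>x. False) (at_right (0 :: real))"
    by eventually_elim (use zero in auto)
  then show False by simp
qed

section \<open>The Hankel function and the derivative of D\<close>

definition euler_H :: "nat \<Rightarrow> complex \<Rightarrow> complex" where
  "euler_H m z = euler_J m z + \<i> * euler_Y m z"

lemma bessel_solution_H: "bessel_solution m (- \<real>\<^sub>\<le>\<^sub>0) (Hankel_H1 m) (euler_H m)"
proof -
  have "bessel_solution m (- \<real>\<^sub>\<le>\<^sub>0) (Bessel_J m) (euler_J m)"
    by (rule bessel_solution_subset[OF bessel_solution_J]) auto
  from bessel_solution_add_cmult[OF this bessel_solution_Y, of \<i>]
  show ?thesis unfolding Hankel_H1_def[abs_def] euler_H_def[abs_def] .
qed

text \<open>The summand J of H drops out, since the Wronskian of J with itself is zero; the summand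
  iY contributes i times the value for Y.\<close>

lemma wronskian_J_H:
  assumes "z \<notin> \<real>\<^sub>\<le>\<^sub>0"
  shows "Bessel_J m z * euler_H m z - euler_J m z * Hankel_H1 m z = 2 * \<i> / of_real pi"
  using arg_cong[OF wronskian_J_Y[OF assms, of m], of "\<lambda>w. \<i> * w"]
  unfolding euler_H_def Hankel_H1_def by (simp add: algebra_simps)

lemma mult_of_real_notin_nonpos_Reals:
  fixes z :: complex
  assumes "n > 0" "z \<notin> \<real>\<^sub>\<le>\<^sub>0"
  shows "of_real n * z \<notin> \<real>\<^sub>\<le>\<^sub>0"
  using assms by (auto simp: complex_nonpos_Reals_iff mult_le_0_iff)

lemma char_D_eq:
  assumes "n > 0" "z \<notin> \<real>\<^sub>\<le>\<^sub>0"
  shows "char_D n m z =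
    (euler_J m (of_real n * z) * Hankel_H1 m z - Bessel_J m (of_real n * z) * euler_H m z) / z"
proof -
  have z: "z \<noteq> 0" using assms by auto
  have "deriv (Bessel_J m) (of_real n * z) = euler_J m (of_real n * z) / (of_real n * z)"
    "deriv (Hankel_H1 m) z = euler_H m z / z"
    using bessel_solution_J[of m] bessel_solution_H[of m] assms z
    by (auto simp: bessel_solution_def intro!: DERIV_imp_deriv)
  note d = this
  show ?thesis unfolding char_D_def d using assms(1) z by (simp add: field_simps)
qed

lemma deriv_char_D:
  assumes "n > 0" "z \<notin> \<real>\<^sub>\<le>\<^sub>0"
  shows "deriv (char_D n m) z =
    (1 - of_real n ^ 2) * Bessel_J m (of_real n * z) * Hankel_H1 m z - char_D n m z / z"
proof -
  have z: "z \<noteq> 0" using assms by auto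
  then have nz: "of_real n * z \<noteq> 0" using assms by simp
  have D: "(Bessel_J m has_field_derivative euler_J m (of_real n * z) / (of_real n * z)) (at (of_real n * z))"
    "(euler_J m has_field_derivative (of_nat m ^ 2 - (of_real n * z)\<^sup>2) * Bessel_J m (of_real n * z) / (of_real n * z)) (at (of_real n * z))"
    "(Hankel_H1 m has_field_derivative euler_H m z / z) (at z)"
    "(euler_H m has_field_derivative (of_nat m ^ 2 - z\<^sup>2) * Hankel_H1 m z / z) (at z)"
    using bessel_solution_J[of m] bessel_solution_H[of m] assms z nz by (auto simp: bessel_solution_def)
  have l: "((\<lambda>z. of_real n * z) has_field_derivative of_real n) (at z)"
    by (auto intro!: derivative_eq_intros)
  have c: "d / (of_real n * z) * of_real n = d / z" for d
    using nz by (simp add: divide_simps)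
  note D' = DERIV_chain2[where f = "Bessel_J m" and g = "\<lambda>z. of_real n * z", OF D(1) l, unfolded c]
    DERIV_chain2[where f = "euler_J m" and g = "\<lambda>z. of_real n * z", OF D(2) l, unfolded c]
  define F where "F = (\<lambda>z. euler_J m (of_real n * z) * Hankel_H1 m z - Bessel_J m (of_real n * z) * euler_H m z)"
  have alg: "((M - (N * z)\<^sup>2) * J / z * H + K / z * I) - (I / z * K + (M - z\<^sup>2) * H / z * J)
      = (1 - N ^ 2) * J * H * z" for M N J H K I :: complex
  proof -
    have "((M - (N * z)\<^sup>2) * J / z * H + K / z * I) - (I / z * K + (M - z\<^sup>2) * H / z * J)
      = ((M - (N * z)\<^sup>2) * J * H - (M - z\<^sup>2) * H * J) / z"
      by (simp add: diff_divide_distrib)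
    also have "(M - (N * z)\<^sup>2) * J * H - (M - z\<^sup>2) * H * J = ((1 - N ^ 2) * J * H * z) * z"
      by algebra
    finally show ?thesis using z by simp
  qed
  have "(F has_field_derivative
      (1 - of_real n ^ 2) * Bessel_J m (of_real n * z) * Hankel_H1 m z * z) (at z)"
    unfolding F_def alg[symmetric, of _ _ _ "of_nat m ^ 2" "euler_H m z" "euler_J m (of_real n * z)"]
    by (intro DERIV_diff DERIV_mult D D')
  from DERIV_divide[OF this DERIV_ident z]
  have "((\<lambda>z. F z / z) has_field_derivative
      (1 - of_real n ^ 2) * Bessel_J m (of_real n * z) * Hankel_H1 m z - F z / z / z) (at z)"
    using z by (simp add: diff_divide_distrib)
  then have "(char_D n m has_field_derivative
      (1 - of_real n ^ 2) * Bessel_J m (of_real n * z) * Hankel_H1 m z - F z / z / z) (at z)"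
    \<comment> \<open>The quotient F(z)/z represents D only off the cut; that set is open, so the
      derivative carries over.\<close>
    by (rule has_field_derivative_transform_within_open[where S = "- \<real>\<^sub>\<le>\<^sub>0"])
       (use assms slit_plane in \<open>auto simp: char_D_eq F_def\<close>)
  then show ?thesis unfolding char_D_eq[OF assms] F_def by (rule DERIV_imp_deriv)
qed

lemma Hankel_H1_real_nonzero:
  assumes "z \<notin> \<real>\<^sub>\<le>\<^sub>0" "z \<in> \<real>"
  shows "Hankel_H1 m z \<noteq> 0"
proof
  assume H: "Hankel_H1 m z = 0"
  from assms obtain x where x: "z = of_real x" "x > 0"
    by (auto elim!: Reals_cases)
  have "Bessel_J m z \<in> \<real>" "Bessel_Y m z \<in> \<real>"
    using Bessel_J_Reals[OF assms(2)] Bessel_Y_Reals x by auto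
  then have "Bessel_J m z = 0" "Bessel_Y m z = 0"
    using H by (auto simp: Hankel_H1_def complex_is_Real_iff complex_eq_iff)
  then show False using wronskian_J_Y[OF assms(1), of m] by simp
qed

theorem theorem9:
  fixes n :: real and m :: nat and z :: complex
  assumes "n > 1"
    and "z \<notin> \<real>\<^sub>\<le>\<^sub>0"
    and "char_D n m z = 0"
  shows "deriv (char_D n m) z \<noteq> 0"
proof
  assume d: "deriv (char_D n m) z = 0"
  have n: "n > 0" using assms(1) by simp
  have z: "z \<noteq> 0" using assms(2) by auto
  let ?w = "of_real n * z"
  have w: "?w \<notin> \<real>\<^sub>\<le>\<^sub>0" using n assms(2) by (rule mult_of_real_notin_nonpos_Reals)
  have "(of_real n ^ 2 :: complex) \<noteq> 1"
    using assms(1) power2_eq_1_iff[of n] by (simp flip: of_real_power)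
  then have prod: "Bessel_J m ?w * Hankel_H1 m z = 0"
    using d unfolding deriv_char_D[OF n assms(2)] assms(3) by simp
  have root: "euler_J m ?w * Hankel_H1 m z = Bessel_J m ?w * euler_H m z"
    using assms(3) z unfolding char_D_eq[OF n assms(2)] by simp
  \<comment> \<open>Otherwise \<open>prod\<close> gives H(z) = 0, then \<open>root\<close> gives
    \<open>euler_H m z\<close> = 0, and the Wronskian at z would vanish.\<close>
  have "Bessel_J m ?w = 0"
    using prod root wronskian_J_H[OF assms(2), of m] by auto
  \<comment> \<open>Otherwise \<open>root\<close> gives \<open>euler_J m ?w\<close> = 0 in addition
    to J(nz) = 0; this time it is the Wronskian at nz that would vanish.\<close>
  moreover from this have "Hankel_H1 m z = 0"
    using root wronskian_J_H[OF w, of m] by auto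
  moreover have "?w \<noteq> 0" using n z by simp
  ultimately have "?w \<in> \<real>" using Bessel_J_zero_real by blast
  then have "z \<in> \<real>" using n by (auto simp: complex_is_Real_iff)
  then show False using Hankel_H1_real_nonzero assms(2) \<open>Hankel_H1 m z = 0\<close> by blast
qed

end
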